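(* Let $n\ge 3$, let $M\ge 1$ and $\bar M=\log M$, let $A\in{\cal P}_n\cap[1/M,M]^{n\times n}$, and put $\bar a_{ij}=\log a_{ij}$. Let $\alpha_n\in[0,1)$ denote the acceptance threshold of inconsistency and let $\alpha_n^*=\log\left(\frac{1}{1-\alpha_n}\right)$. Consider the linear mixed 0-1 optimization problem in the real variables $x_{ij}$ ($1\le i,j\le n$) and the binary variables $y_{ij}$ ($1\le i<j\le n$): $$\begin{array}{rll} \min & \sum_{i=1}^{n-1}\sum_{j=i+1}^{n} y_{ij} & \\ \mathrm{s.t.} & x_{ij}+x_{jk}+x_{ki}\le \alpha_n^*, & 1\le i<j<k\le n,\\ & -(x_{ij}+x_{jk}+x_{ki})\le \alpha_n^*, & 1\le i<j<k\le n,\\ & x_{ij}=-x_{ji}, & 1\le i\le j\le n,\\ & -\bar M\le x_{ij}\le \bar M, & 1\le i<j\le n,\\ & -2\bar M y_{ij}\le x_{ij}-\bar a_{ij}\le 2\bar M y_{ij}, & 1\le i<j\le n,\\ & y_{ij}\in\{0,1\}, & 1\le i<j\le n. \end{array}$$ Then the optimum value of this problem equals the minimal number of elements above the main diagonal of $A$ that have to be modified (together with their reciprocals) in order to achieve $CM\le\alpha_n$, i.e. it equals $$\min\{\,d(A,\hat A)\ :\ \hat A\in{\cal P}_n\cap[1/M,M]^{n\times n},\ CM(\hat A)\le\alpha_n\,\}.$$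
   Context: ${\cal P}_n$ is the set of $n\times n$ pairwise comparison matrices: real matrices $A=(a_{ij})$ with $a_{ij}>0$ and $a_{ij}=1/a_{ji}$ for all $i,j$ (so $a_{ii}=1$). $[1/M,M]^{n\times n}$ is the set of $n\times n$ matrices all of whose entries lie in $[1/M,M]$. For $A,\hat A\in{\cal P}_n$, $d(A,\hat A)=|\{(i,j):1\le i<j\le n,\ a_{ij}\ne\hat a_{ij}\}|$. For positive reals $a,b,c$ let $$CM(a,b,c)=\min\left\{\frac1a\left|a-\frac bc\right|,\ \frac1b\left|b-ac\right|,\ \frac1c\left|c-\frac ba\right|\right\},$$ and for $A\in{\cal P}_n$ let $CM(A)=\max\{CM(a_{ij},a_{ik},a_{jk}) : 1\le i<j<k\le n\}$ (the inconsistency index of Koczkodaj and Duszak; it takes values in $[0,1)$). *)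

theory Defs
  imports Complex_Main "Jordan_Normal_Form.Matrix"
begin

text \<open>Matrix indices start at 0, so \<open>1 \<le> i < j \<le> n\<close> is rendered as \<open>i < j\<close> and \<open>j < n\<close>.\<close>

definition pcm :: "nat \<Rightarrow> real mat set" where
  "pcm n = {A \<in> carrier_mat n n.
     \<forall>i<n. \<forall>j<n. A $$ (i,j) > 0 \<and> A $$ (i,j) = 1 / A $$ (j,i)}"

definition box_mat :: "nat \<Rightarrow> real \<Rightarrow> real mat set" where
  "box_mat n M = {A \<in> carrier_mat n n. \<forall>i<n. \<forall>j<n. A $$ (i,j) \<in> {1/M..M}}"

definition num_modified :: "nat \<Rightarrow> real mat \<Rightarrow> real mat \<Rightarrow> nat" where
  "num_modified n A B = card {(i,j). i < j \<and> j < n \<and> A $$ (i,j) \<noteq> B $$ (i,j)}"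

definition CM_triad :: "real \<Rightarrow> real \<Rightarrow> real \<Rightarrow> real" where
  "CM_triad a b c = Min {1/a * \<bar>a - b/c\<bar>, 1/b * \<bar>b - a*c\<bar>, 1/c * \<bar>c - b/a\<bar>}"

text \<open>The set below is finite, and it is nonempty exactly if \<open>n \<ge> 3\<close>;
  otherwise \<^const>\<open>Max\<close> is unspecified.\<close>

definition CM :: "nat \<Rightarrow> real mat \<Rightarrow> real" where
  "CM n A = Max {CM_triad (A $$ (i,j)) (A $$ (i,k)) (A $$ (j,k)) | i j k.
     i < j \<and> j < k \<and> k < n}"

text \<open>The variables are families \<open>x\<close>, \<open>y\<close> on \<open>nat \<Rightarrow> nat\<close>; only the values at indices
  occurring in the problem are constrained or enter the objective. The parameters are the
  data \<open>\<alpha>\<^sup>*\<close>, \<open>log M\<close> and \<open>log a\<^sub>i\<^sub>j\<close>.\<close>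

definition milp_feasible ::
  "nat \<Rightarrow> real \<Rightarrow> real \<Rightarrow> (nat \<Rightarrow> nat \<Rightarrow> real) \<Rightarrow> (nat \<Rightarrow> nat \<Rightarrow> real) \<Rightarrow> (nat \<Rightarrow> nat \<Rightarrow> real) \<Rightarrow> bool"
where
  "milp_feasible n \<alpha>s Mb ab x y \<longleftrightarrow>
     (\<forall>i j k. i < j \<and> j < k \<and> k < n \<longrightarrow> x i j + x j k + x k i \<le> \<alpha>s) \<and>
     (\<forall>i j k. i < j \<and> j < k \<and> k < n \<longrightarrow> - (x i j + x j k + x k i) \<le> \<alpha>s) \<and>
     (\<forall>i j. i \<le> j \<and> j < n \<longrightarrow> x i j = - x j i) \<and>
     (\<forall>i j. i < j \<and> j < n \<longrightarrow> - Mb \<le> x i j \<and> x i j \<le> Mb) \<and>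
     (\<forall>i j. i < j \<and> j < n \<longrightarrow>
        - 2 * Mb * y i j \<le> x i j - ab i j \<and> x i j - ab i j \<le> 2 * Mb * y i j) \<and>
     (\<forall>i j. i < j \<and> j < n \<longrightarrow> y i j \<in> {0, 1})"

definition milp_objective :: "nat \<Rightarrow> (nat \<Rightarrow> nat \<Rightarrow> real) \<Rightarrow> real" where
  "milp_objective n y = (\<Sum>i<n-1. \<Sum>j=i+1..<n. y i j)"

definition is_minimum :: "'a::linorder set \<Rightarrow> 'a \<Rightarrow> bool" where
  "is_minimum S v \<longleftrightarrow> v \<in> S \<and> (\<forall>s\<in>S. v \<le> s)"

end

theory Submission
  imports Defs
begin

text \<open>
  Taking logarithms linearizes the problem. For positive \<open>a, b, c\<close> put
  \<open>s = ln a + ln c - ln b\<close>. The three relative deviations in the inconsistency index of the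
  triad are \<open>\<bar>1 - exp (- s)\<bar>\<close>, \<open>\<bar>1 - exp s\<bar>\<close> and again \<open>\<bar>1 - exp (- s)\<bar>\<close>, and the least of
  them is \<open>1 - exp (- \<bar>s\<bar>)\<close>, an increasing function of \<open>\<bar>s\<bar>\<close>
  (\<open>CM_triad_eq\<close>). So the index is at most \<open>\<alpha>\<close> iff \<open>\<bar>s\<bar> \<le> ln (1 / (1 - \<alpha>))\<close>, which is the pair
  of linear triad constraints with \<open>x i j\<close> in the role of the logarithm of the matrix entry.

  Entrywise \<open>ln\<close> and \<open>exp\<close> therefore translate between admissible matrices \<open>B\<close> and the
  \<open>x\<close>-parts of feasible points. The big-M constraint \<open>\<bar>x i j - ln a\<^sub>i\<^sub>j\<bar> \<le> 2 ln M * y i j\<close> forces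
  \<open>x i j = ln a\<^sub>i\<^sub>j\<close> when \<open>y i j = 0\<close>, and it is vacuous when \<open>y i j = 1\<close>, because both numbers
  lie in \<open>[- ln M, ln M]\<close>. Hence a matrix \<open>B\<close> yields a feasible point whose objective is
  exactly the number of modified entries above the diagonal (\<open>feasible_point_of_matrix\<close>),
  while a feasible point yields a matrix with at most as many modified entries as its
  objective (\<open>matrix_of_feasible_point\<close>): a feasible point may waste a \<open>y i j = 1\<close> on an
  unchanged entry. So the attainable counts are objective values, and every objective value is
  bounded below by an attainable count, which makes the two minima equal. They exist since the counts form a
  set of natural numbers, nonempty because the all-ones matrix is admissible.
\<close>

text \<open>
  The minimum over the two distinct deviations is reached on the side where the exponential
  is below 1, since \<open>exp s + exp (- s) \<ge> 2\<close>.
\<close>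

lemma CM_triad_eq:
  assumes "a > 0" "b > 0" "c > 0"
  shows "CM_triad a b c = 1 - exp (- \<bar>ln a + ln c - ln b\<bar>)"
proof -
  define s where "s = ln a + ln c - ln b"
  have es: "exp s = a * c / b"
    using assms by (simp add: s_def exp_add exp_diff)
  have ems: "exp (- s) = b / (a * c)"
    using assms es by (simp add: exp_minus)
  have scale: "1 / r * \<bar>r - u\<bar> = \<bar>1 - u / r\<bar>" if "r > 0" for r u :: real
  proof -
    have "1 - u / r = (r - u) / r"
      using that by (simp add: diff_divide_distrib)
    with that show ?thesis
      by simp
  qed
  have 1: "1 / a * \<bar>a - b / c\<bar> = \<bar>1 - exp (- s)\<bar>"
    using scale[OF assms(1), of "b / c"] by (simp add: ems mult.commute)
  have 2: "1 / b * \<bar>b - a * c\<bar> = \<bar>1 - exp s\<bar>"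
    using scale[OF assms(2), of "a * c"] by (simp add: es)
  have 3: "1 / c * \<bar>c - b / a\<bar> = \<bar>1 - exp (- s)\<bar>"
    using scale[OF assms(3), of "b / a"] by (simp add: ems)
  have "CM_triad a b c = min \<bar>1 - exp (- s)\<bar> \<bar>1 - exp s\<bar>"
    unfolding CM_triad_def 1 2 3 by (simp add: insert_commute)
  also have "\<dots> = 1 - exp (- \<bar>s\<bar>)"
  proof -
    have sum_ge: "exp s + exp (- s) \<ge> 2"
      using cosh_real_ge_1[of s] by (simp add: cosh_field_def)
    show ?thesis
    proof (cases "s \<ge> 0")
      case True
      then have "exp s \<ge> 1" "exp (- s) \<le> 1"
        by simp_all
      with True sum_ge show ?thesis
        by (simp add: min_def)
    next
      case False
      then have "exp s \<le> 1" "exp (- s) \<ge> 1"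
        by simp_all
      with False sum_ge show ?thesis
        by (simp add: min_def)
    qed
  qed
  finally show ?thesis
    by (simp add: s_def)
qed

lemma CM_triad_le_iff:
  assumes "a > 0" "b > 0" "c > 0" and "\<alpha> < 1"
  shows "CM_triad a b c \<le> \<alpha> \<longleftrightarrow> \<bar>ln a + ln c - ln b\<bar> \<le> ln (1 / (1 - \<alpha>))"
proof -
  have "CM_triad a b c \<le> \<alpha> \<longleftrightarrow> 1 - \<alpha> \<le> exp (- \<bar>ln a + ln c - ln b\<bar>)"
    using CM_triad_eq[OF assms(1-3)] by auto
  also have "\<dots> \<longleftrightarrow> ln (1 - \<alpha>) \<le> - \<bar>ln a + ln c - ln b\<bar>"
    using assms(4) by (metis diff_gt_0_iff_gt exp_le_cancel_iff exp_ln)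
  also have "\<dots> \<longleftrightarrow> \<bar>ln a + ln c - ln b\<bar> \<le> ln (1 / (1 - \<alpha>))"
    using assms(4) by (auto simp: ln_div)
  finally show ?thesis .
qed

lemma CM_le_iff:
  assumes "n \<ge> 3"
  shows "CM n B \<le> \<alpha> \<longleftrightarrow>
    (\<forall>i j k. i < j \<and> j < k \<and> k < n \<longrightarrow> CM_triad (B $$ (i,j)) (B $$ (i,k)) (B $$ (j,k)) \<le> \<alpha>)"
proof -
  let ?f = "\<lambda>(i,j,k). CM_triad (B $$ (i,j)) (B $$ (i,k)) (B $$ (j,k))"
  let ?T = "{(i,j,k). i < j \<and> j < k \<and> k < n}"
  have eq: "{CM_triad (B $$ (i,j)) (B $$ (i,k)) (B $$ (j,k)) | i j k. i < j \<and> j < k \<and> k < n}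
      = ?f ` ?T"
    by force
  have "finite ?T"
    by (rule finite_subset[of _ "{..<n} \<times> {..<n} \<times> {..<n}"]) auto
  moreover have "(0, 1, 2) \<in> ?T"
    using assms by simp
  then have "?T \<noteq> {}"
    by blast
  ultimately show ?thesis
    unfolding CM_def eq by (subst Max_le_iff) auto
qed

lemma pcm_pos: "B \<in> pcm n \<Longrightarrow> i < n \<Longrightarrow> j < n \<Longrightarrow> B $$ (i,j) > 0"
  unfolding pcm_def by blast

lemma pcm_ln_antisym:
  assumes "B \<in> pcm n" "i < n" "j < n"
  shows "ln (B $$ (i,j)) = - ln (B $$ (j,i))"
proof -
  have "B $$ (j,i) > 0" "B $$ (i,j) = 1 / B $$ (j,i)"
    using assms unfolding pcm_def by blast+
  then show ?thesis
    by (simp add: ln_div)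
qed

lemma CM_le_iff_ln:
  assumes "n \<ge> 3" "B \<in> pcm n" "\<alpha> < 1"
  shows "CM n B \<le> \<alpha> \<longleftrightarrow>
    (\<forall>i j k. i < j \<and> j < k \<and> k < n \<longrightarrow>
      \<bar>ln (B $$ (i,j)) + ln (B $$ (j,k)) + ln (B $$ (k,i))\<bar> \<le> ln (1 / (1 - \<alpha>)))"
proof -
  have "CM_triad (B $$ (i,j)) (B $$ (i,k)) (B $$ (j,k)) \<le> \<alpha> \<longleftrightarrow>
      \<bar>ln (B $$ (i,j)) + ln (B $$ (j,k)) + ln (B $$ (k,i))\<bar> \<le> ln (1 / (1 - \<alpha>))"
    if "i < j" "j < k" "k < n" for i j k
  proof -
    have "B $$ (i,j) > 0" "B $$ (i,k) > 0" "B $$ (j,k) > 0"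
      using pcm_pos[OF assms(2)] that by simp_all
    moreover have "ln (B $$ (k,i)) = - ln (B $$ (i,k))"
      using pcm_ln_antisym[OF assms(2), of k i] that by linarith
    ultimately show ?thesis
      using CM_triad_le_iff assms(3) by simp
  qed
  then show ?thesis
    unfolding CM_le_iff[OF assms(1)] by blast
qed

lemma box_mat_ln_bounds:
  assumes "B \<in> box_mat n M" "M \<ge> 1" "i < n" "j < n"
  shows "- ln M \<le> ln (B $$ (i,j))" "ln (B $$ (i,j)) \<le> ln M"
proof -
  have b: "1 / M \<le> B $$ (i,j)" "B $$ (i,j) \<le> M"
    using assms unfolding box_mat_def by auto
  have "0 < 1 / M"
    using assms(2) by simp
  with b have pos: "0 < B $$ (i,j)"
    by linarith
  have "ln (1 / M) \<le> ln (B $$ (i,j))"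
    using b(1) \<open>0 < 1 / M\<close> pos by (subst ln_le_cancel_iff)
  then show "- ln M \<le> ln (B $$ (i,j))"
    using assms(2) by (simp add: ln_div)
  show "ln (B $$ (i,j)) \<le> ln M"
    using b(2) pos by simp
qed

lemma finite_upper_pairs: "finite {(i,j). i < j \<and> j < (n::nat)}"
  by (rule finite_subset[of _ "{..<n} \<times> {..<n}"]) auto

lemma milp_objective_eq:
  "milp_objective n y = (\<Sum>(i,j)\<in>{(i,j). i < j \<and> j < n}. y i j)"
proof -
  have "{(i,j). i < j \<and> j < n} = Sigma {..<n-1} (\<lambda>i. {i+1..<n})"
    by auto
  then show ?thesis
    unfolding milp_objective_def by (simp add: sum.Sigma)
qed

lemma num_modified_eq:
  "real (num_modified n A B) =
    (\<Sum>(i,j)\<in>{(i,j). i < j \<and> j < n}. if A $$ (i,j) \<noteq> B $$ (i,j) then 1 else 0)"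
proof -
  let ?P = "{(i,j). i < j \<and> j < n}"
  have "{(i,j). i < j \<and> j < n \<and> A $$ (i,j) \<noteq> B $$ (i,j)}
      = {p \<in> ?P. A $$ p \<noteq> B $$ p}"
    by auto
  then have "real (num_modified n A B) = (\<Sum>p\<in>{p \<in> ?P. A $$ p \<noteq> B $$ p}. 1)"
    unfolding num_modified_def by simp
  also have "\<dots> = (\<Sum>p\<in>?P. if A $$ p \<noteq> B $$ p then 1 else 0)"
    by (rule sum.inter_filter[OF finite_upper_pairs])
  finally show ?thesis
    by (simp add: case_prod_unfold)
qed

text \<open>
  The witness sets \<open>y i j = 1\<close> only where \<open>B\<close> differs from \<open>A\<close>. There the bound
  \<open>2 * ln M\<close> is large enough because the logarithms of both entries lie in an
  interval of that length; elsewhere the deviation is 0.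
\<close>

lemma feasible_point_of_matrix:
  assumes "n \<ge> 3" "M \<ge> 1" "\<alpha> < 1" "A \<in> box_mat n M"
    and B: "B \<in> pcm n" "B \<in> box_mat n M" "CM n B \<le> \<alpha>"
  shows "\<exists>x y. milp_feasible n (ln (1 / (1 - \<alpha>))) (ln M) (\<lambda>i j. ln (A $$ (i,j))) x y \<and>
    milp_objective n y = real (num_modified n A B)"
proof -
  define x where "x = (\<lambda>i j. ln (B $$ (i,j)))"
  define y :: "nat \<Rightarrow> nat \<Rightarrow> real" where
    "y = (\<lambda>i j. if A $$ (i,j) \<noteq> B $$ (i,j) then 1 else 0)"
  have triad: "\<bar>x i j + x j k + x k i\<bar> \<le> ln (1 / (1 - \<alpha>))"
    if "i < j" "j < k" "k < n" for i j k
    using B CM_le_iff_ln assms(1,3) that unfolding x_def by blast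
  have anti: "x i j = - x j i" if "i \<le> j" "j < n" for i j
    using pcm_ln_antisym[OF B(1), of i j] that unfolding x_def by linarith
  have box: "- ln M \<le> x i j \<and> x i j \<le> ln M" if "i < j" "j < n" for i j
    using box_mat_ln_bounds[OF B(2) assms(2)] that unfolding x_def by simp
  have dev: "- 2 * ln M * y i j \<le> x i j - ln (A $$ (i,j)) \<and>
      x i j - ln (A $$ (i,j)) \<le> 2 * ln M * y i j" if "i < j" "j < n" for i j
  proof -
    have "- ln M \<le> ln (A $$ (i,j))" "ln (A $$ (i,j)) \<le> ln M"
      using box_mat_ln_bounds[OF assms(4,2)] that by simp_all
    with box[OF that] show ?thesis
      by (auto simp: y_def x_def)
  qed
  have "milp_feasible n (ln (1 / (1 - \<alpha>))) (ln M) (\<lambda>i j. ln (A $$ (i,j))) x y"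
    unfolding milp_feasible_def
  proof (intro conjI allI impI; elim conjE)
    fix i j k assume "i < j" "j < k" "k < n"
    from triad[OF this] show "x i j + x j k + x k i \<le> ln (1 / (1 - \<alpha>))"
      and "- (x i j + x j k + x k i) \<le> ln (1 / (1 - \<alpha>))"
      by linarith+
  next
    fix i j assume "i \<le> j" "j < n"
    then show "x i j = - x j i"
      by (rule anti)
  qed (use box dev in \<open>auto simp: y_def\<close>)
  moreover have "milp_objective n y = real (num_modified n A B)"
    by (simp add: milp_objective_eq num_modified_eq y_def)
  ultimately show ?thesis
    by blast
qed

text \<open>
  The witness is the entrywise exponential of \<open>x\<close>, which is reciprocal because \<open>x\<close> is
  antisymmetric. Only an inequality holds between the counts: \<open>y i j = 0\<close> forces the entry to be
  kept, but \<open>y i j = 1\<close> does not force a change.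
\<close>

lemma matrix_of_feasible_point:
  assumes "n \<ge> 3" "M \<ge> 1" "\<alpha> < 1" "A \<in> pcm n"
    and feas: "milp_feasible n (ln (1 / (1 - \<alpha>))) (ln M) (\<lambda>i j. ln (A $$ (i,j))) x y"
  shows "\<exists>B. B \<in> pcm n \<inter> box_mat n M \<and> CM n B \<le> \<alpha> \<and>
    real (num_modified n A B) \<le> milp_objective n y"
proof -
  define B where "B = mat n n (\<lambda>(i,j). exp (x i j))"
  have B: "B $$ (i,j) = exp (x i j)" if "i < n" "j < n" for i j
    using that by (simp add: B_def)
  have carrier: "B \<in> carrier_mat n n"
    by (simp add: B_def)
  have triad: "\<forall>i j k. i < j \<and> j < k \<and> k < n \<longrightarrow> x i j + x j k + x k i \<le> ln (1 / (1 - \<alpha>))"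
    and triad': "\<forall>i j k. i < j \<and> j < k \<and> k < n \<longrightarrow>
      - (x i j + x j k + x k i) \<le> ln (1 / (1 - \<alpha>))"
    and anti_le: "\<forall>i j. i \<le> j \<and> j < n \<longrightarrow> x i j = - x j i"
    and upper: "\<forall>i j. i < j \<and> j < n \<longrightarrow> - ln M \<le> x i j \<and> x i j \<le> ln M"
    and dev: "\<forall>i j. i < j \<and> j < n \<longrightarrow> - 2 * ln M * y i j \<le> x i j - ln (A $$ (i,j)) \<and>
      x i j - ln (A $$ (i,j)) \<le> 2 * ln M * y i j"
    and binary: "\<forall>i j. i < j \<and> j < n \<longrightarrow> y i j \<in> {0, 1}"
    using feas unfolding milp_feasible_def by - (elim conjE, assumption)+
  have anti: "x i j = - x j i" if "i < n" "j < n" for i j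
  proof -
    from anti_le have "i \<le> j \<Longrightarrow> x i j = - x j i" "j \<le> i \<Longrightarrow> x j i = - x i j"
      using that by blast+
    then show ?thesis
      by linarith
  qed
  have box: "- ln M \<le> x i j \<and> x i j \<le> ln M" if "i < n" "j < n" for i j
  proof (cases i j rule: linorder_cases)
    case less
    then show ?thesis
      using upper that by blast
  next
    case equal
    have "x j j = 0"
      using anti[OF that(2) that(2)] by linarith
    with equal assms(2) show ?thesis
      by simp
  next
    case greater
    then show ?thesis
      using upper[rule_format, of j i] anti[OF that] that by linarith
  qed
  have "B \<in> pcm n"
    unfolding pcm_def
  proof (intro CollectI conjI carrier allI impI)
    fix i j assume ij: "i < n" "j < n"
    show "B $$ (i,j) > 0"
      using B ij by simp
    show "B $$ (i,j) = 1 / B $$ (j,i)"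
      using B ij anti[OF ij] by (simp add: exp_minus inverse_eq_divide)
  qed
  moreover have "B \<in> box_mat n M"
    unfolding box_mat_def
  proof (intro CollectI conjI carrier allI impI)
    fix i j assume ij: "i < n" "j < n"
    have "exp (- ln M) \<le> exp (x i j)" "exp (x i j) \<le> exp (ln M)"
      using box[OF ij] by simp_all
    then show "B $$ (i,j) \<in> {1/M..M}"
      using B ij assms(2) by (simp add: exp_minus inverse_eq_divide)
  qed
  moreover have "CM n B \<le> \<alpha>"
    unfolding CM_le_iff_ln[OF assms(1) \<open>B \<in> pcm n\<close> assms(3)]
  proof (intro allI impI; elim conjE)
    fix i j k assume ijk: "i < j" "j < k" "k < n"
    have "x i j + x j k + x k i \<le> ln (1 / (1 - \<alpha>))"
      and "- (x i j + x j k + x k i) \<le> ln (1 / (1 - \<alpha>))"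
      using triad triad' ijk by blast+
    then have "\<bar>x i j + x j k + x k i\<bar> \<le> ln (1 / (1 - \<alpha>))"
      by linarith
    then show "\<bar>ln (B $$ (i,j)) + ln (B $$ (j,k)) + ln (B $$ (k,i))\<bar> \<le> ln (1 / (1 - \<alpha>))"
      using B ijk by simp
  qed
  moreover have "real (num_modified n A B) \<le> milp_objective n y"
    unfolding num_modified_eq milp_objective_eq
  proof (rule sum_mono, clarify)
    fix i j assume ij: "i < j" "j < n"
    have "A $$ (i,j) = B $$ (i,j)" if "y i j = 0"
    proof -
      have "x i j = ln (A $$ (i,j))"
        using dev[rule_format, of i j] ij that by simp
      moreover have "A $$ (i,j) > 0"
        using pcm_pos[OF assms(4)] ij by simp
      ultimately show ?thesis
        using B ij by simp
    qed
    moreover have "y i j \<in> {0, 1}"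
      using binary ij by blast
    ultimately show "(if A $$ (i,j) \<noteq> B $$ (i,j) then 1 else 0) \<le> y i j"
      by auto
  qed
  ultimately show ?thesis
    by blast
qed

lemma all_ones_admissible:
  assumes "n \<ge> 3" "M \<ge> 1" "0 \<le> \<alpha>" "\<alpha> < 1"
  shows "\<exists>B. B \<in> pcm n \<inter> box_mat n M \<and> CM n B \<le> \<alpha>"
proof -
  define B :: "real mat" where "B = mat n n (\<lambda>_. 1)"
  have "B \<in> pcm n" "B \<in> box_mat n M"
    using assms(2) by (auto simp: B_def pcm_def box_mat_def)
  moreover have "CM n B \<le> \<alpha>"
    unfolding CM_le_iff[OF assms(1)] using assms(3) by (auto simp: B_def CM_triad_def)
  ultimately show ?thesis
    by blast
qed

theorem theorem6:
  fixes n :: nat and M \<alpha> :: real and A :: "real mat"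
  assumes "n \<ge> 3" and "M \<ge> 1"
    and "A \<in> pcm n \<inter> box_mat n M"
    and "0 \<le> \<alpha>" and "\<alpha> < 1"
  shows "\<exists>v::nat.
    is_minimum {milp_objective n y | x y.
        milp_feasible n (ln (1 / (1 - \<alpha>))) (ln M) (\<lambda>i j. ln (A $$ (i,j))) x y} (real v) \<and>
    is_minimum {num_modified n A B | B. B \<in> pcm n \<inter> box_mat n M \<and> CM n B \<le> \<alpha>} v"
proof -
  let ?S = "{num_modified n A B | B. B \<in> pcm n \<inter> box_mat n M \<and> CM n B \<le> \<alpha>}"
  let ?T = "{milp_objective n y | x y.
        milp_feasible n (ln (1 / (1 - \<alpha>))) (ln M) (\<lambda>i j. ln (A $$ (i,j))) x y}"
  have A: "A \<in> pcm n" "A \<in> box_mat n M"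
    using assms(3) by auto
  define v where "v = (LEAST d. d \<in> ?S)"
  have "\<exists>d. d \<in> ?S"
    using all_ones_admissible[OF assms(1,2,4,5)] by blast
  then have v_in: "v \<in> ?S"
    unfolding v_def by (rule LeastI_ex)
  have v_le: "v \<le> d" if "d \<in> ?S" for d
    unfolding v_def using that by (rule Least_le)
  have "real v \<in> ?T"
  proof -
    from v_in obtain B where "v = num_modified n A B"
      and "B \<in> pcm n" "B \<in> box_mat n M" "CM n B \<le> \<alpha>"
      by blast
    with feasible_point_of_matrix[OF assms(1,2,5) A(2)] show ?thesis
      by (metis (mono_tags, lifting) mem_Collect_eq)
  qed
  moreover have "real v \<le> t" if "t \<in> ?T" for t
  proof -
    from that obtain x y where t: "t = milp_objective n y"
      and feas: "milp_feasible n (ln (1 / (1 - \<alpha>))) (ln M) (\<lambda>i j. ln (A $$ (i,j))) x y"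
      by blast
    obtain B where B: "B \<in> pcm n \<inter> box_mat n M" "CM n B \<le> \<alpha>"
      and le: "real (num_modified n A B) \<le> t"
      using matrix_of_feasible_point[OF assms(1,2,5) A(1) feas] t by blast
    have "v \<le> num_modified n A B"
      by (rule v_le) (use B in blast)
    with le show ?thesis
      by linarith
  qed
  ultimately show ?thesis
    unfolding is_minimum_def using v_in v_le by blast
qed

end
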